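(* Let $n$ be a positive integer, and let $X_n(\mu,\nu)=W_1(\mu,\nu)$ be the $1$-Wasserstein distance regarded as a random variable on the probability space $\Omega_n=\mathcal{P}_n\times\mathcal{P}_n$ equipped with the uniform (normalized Lebesgue) product probability measure. Then the second moment of $X_n$ is $$\mathbb{E}(X_n^2)=\frac{(n-1)(7n-4)}{30n}.$$
   Context: Let $[n]=\{1,\dots,n\}$ with the metric $d(x,y)=|x-y|$. $\mathcal{P}_n$ denotes the set of all probability measures on $[n]$, identified with the standard simplex $\{(p_1,\dots,p_n)\in\mathbb{R}^n : p_i\ge 0,\ \sum_{i=1}^n p_i=1\}$. It carries the uniform probability measure, i.e. the $(n-1)$-dimensional Lebesgue measure on the simplex normalized to have total mass one. $\Omega_n=\mathcal{P}_n\times\mathcal{P}_n$ carries the product of these uniform probability measures, and $\mathbb{E}$ denotes expectation with respect to it. For $\mu,\nu\in\mathcal{P}_n$, the $1$-Wasserstein distance is $$W_1(\mu,\nu)=\inf_{\pi\in\Pi(\mu,\nu)}\int_{[n]\times[n]}|x-y|\,d\pi(x,y),$$ where $\Pi(\mu,\nu)$ is the set of probability measures on $[n]\times[n]$ with first marginal $\mu$ and second marginal $\nu$. Equivalently (a known fact), $W_1(\mu,\nu)=\sum_{i=1}^n|F_\mu(i)-F_\nu(i)|$, where $F_\mu(i)=\mu(\{1,\dots,i\})$ and $F_\nu(i)=\nu(\{1,\dots,i\})$ are the cumulative distribution functions. *)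

theory Defs
  imports "HOL-Probability.Probability"
begin

definition prob_simplex :: "nat \<Rightarrow> (nat \<Rightarrow> real) set" where
  "prob_simplex n =
     {p \<in> extensional {1..n}. (\<forall>i\<in>{1..n}. 0 \<le> p i) \<and> (\<Sum>i\<in>{1..n}. p i) = 1}"

definition pmf_of_vec :: "nat \<Rightarrow> (nat \<Rightarrow> real) \<Rightarrow> nat pmf" where
  "pmf_of_vec n p = embed_pmf (\<lambda>i. if i \<in> {1..n} then p i else 0)"

definition corner_simplex :: "nat \<Rightarrow> (nat \<Rightarrow> real) set" where
  "corner_simplex n =
     {x \<in> extensional {1..<n}. (\<forall>i\<in>{1..<n}. 0 \<le> x i) \<and> (\<Sum>i\<in>{1..<n}. x i) \<le> 1}"

definition simplex_chart :: "nat \<Rightarrow> (nat \<Rightarrow> real) \<Rightarrow> (nat \<Rightarrow> real)" where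
  "simplex_chart n x = (\<lambda>i\<in>{1..n}. if i < n then x i else 1 - (\<Sum>j\<in>{1..<n}. x j))"

(* The chart is an affine bijection from corner_simplex n onto prob_simplex n that multiplies
   (n-1)-dimensional volume by the constant factor sqrt n. The image measure below is therefore
   the (n-1)-dimensional Lebesgue measure on the simplex up to that factor, which cancels when
   the total mass is normalized to one in uniform_simplex. *)
definition simplex_volume :: "nat \<Rightarrow> (nat \<Rightarrow> real) measure" where
  "simplex_volume n =
     distr (restrict_space (Pi\<^sub>M {1..<n} (\<lambda>_. lborel)) (corner_simplex n))
           (restrict_space (Pi\<^sub>M {1..n} (\<lambda>_. borel)) (prob_simplex n))
           (simplex_chart n)"

definition uniform_simplex :: "nat \<Rightarrow> (nat \<Rightarrow> real) measure" where
  "uniform_simplex n = uniform_measure (simplex_volume n) (prob_simplex n)"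

definition Omega :: "nat \<Rightarrow> ((nat \<Rightarrow> real) \<times> (nat \<Rightarrow> real)) measure" where
  "Omega n = uniform_simplex n \<Otimes>\<^sub>M uniform_simplex n"

definition couplings :: "nat pmf \<Rightarrow> nat pmf \<Rightarrow> (nat \<times> nat) pmf set" where
  "couplings \<mu> \<nu> = {\<pi>. map_pmf fst \<pi> = \<mu> \<and> map_pmf snd \<pi> = \<nu>}"

(* Meaningful for finitely supported arguments only: there every coupling is finitely supported,
   so the integrals are genuine (a non-integrable cost would be given the value 0). *)
definition W1 :: "nat pmf \<Rightarrow> nat pmf \<Rightarrow> real" where
  "W1 \<mu> \<nu> = (INF \<pi>\<in>couplings \<mu> \<nu>.
      measure_pmf.expectation \<pi> (\<lambda>(x, y). \<bar>real x - real y\<bar>))"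

definition X :: "nat \<Rightarrow> (nat \<Rightarrow> real) \<times> (nat \<Rightarrow> real) \<Rightarrow> real" where
  "X n = (\<lambda>(p, q). W1 (pmf_of_vec n p) (pmf_of_vec n q))"

lemma nn_integral_vec:
  assumes "p \<in> prob_simplex n"
  shows "(\<integral>\<^sup>+i. ennreal (if i \<in> {1..n} then p i else 0) \<partial>count_space UNIV) = 1"
proof -
  have "(\<integral>\<^sup>+i. ennreal (if i \<in> {1..n} then p i else 0) \<partial>count_space UNIV)
      = (\<Sum>i\<in>{1..n}. ennreal (if i \<in> {1..n} then p i else 0))"
    by (rule nn_integral_count_space') auto
  also have "\<dots> = (\<Sum>i\<in>{1..n}. ennreal (p i))"
    by (intro sum.cong) auto
  also have "\<dots> = ennreal (\<Sum>i\<in>{1..n}. p i)"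
    using assms by (intro sum_ennreal) (auto simp: prob_simplex_def)
  finally show ?thesis
    using assms by (simp add: prob_simplex_def)
qed

lemma pmf_pmf_of_vec:
  assumes "p \<in> prob_simplex n"
  shows "pmf (pmf_of_vec n p) i = (if i \<in> {1..n} then p i else 0)"
  unfolding pmf_of_vec_def
  by (rule pmf_embed_pmf[OF _ nn_integral_vec[OF assms]])
     (use assms in \<open>auto simp: prob_simplex_def\<close>)

lemma bij_betw_pmf_of_vec:
  "bij_betw (pmf_of_vec n) (prob_simplex n) {\<mu>. set_pmf \<mu> \<subseteq> {1..n}}"
proof (rule bij_betwI[where g = "\<lambda>\<mu>. restrict (pmf \<mu>) {1..n}"])
  show "pmf_of_vec n \<in> prob_simplex n \<rightarrow> {\<mu>. set_pmf \<mu> \<subseteq> {1..n}}"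
    by (auto simp: set_pmf_eq pmf_pmf_of_vec split: if_splits)
  show vec: "(\<lambda>\<mu>. restrict (pmf \<mu>) {1..n}) \<in> {\<mu>. set_pmf \<mu> \<subseteq> {1..n}} \<rightarrow> prob_simplex n"
    by (auto simp: prob_simplex_def sum_pmf_eq_1)
  show "restrict (pmf (pmf_of_vec n p)) {1..n} = p" if "p \<in> prob_simplex n" for p
    using that
    by (auto simp: pmf_pmf_of_vec prob_simplex_def restrict_def extensional_def fun_eq_iff)
  show "pmf_of_vec n (restrict (pmf \<mu>) {1..n}) = \<mu>" if "\<mu> \<in> {\<mu>. set_pmf \<mu> \<subseteq> {1..n}}" for \<mu>
    using that funcset_mem[OF vec that]
    by (intro pmf_eqI) (auto simp: pmf_pmf_of_vec set_pmf_eq)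
qed

lemma bij_betw_simplex_chart:
  assumes "n \<ge> 1"
  shows "bij_betw (simplex_chart n) (corner_simplex n) (prob_simplex n)"
proof -
  have split: "{1..n} = insert n {1..<n}" using assms by auto
  have sum_split: "(\<Sum>i\<in>{1..n}. f i) = f n + (\<Sum>i\<in>{1..<n}. f i)" for f :: "nat \<Rightarrow> real"
    unfolding split by simp
  show ?thesis
  proof (rule bij_betwI[where g = "\<lambda>p. restrict p {1..<n}"])
    show "simplex_chart n \<in> corner_simplex n \<rightarrow> prob_simplex n"
      using assms by (auto simp: corner_simplex_def prob_simplex_def simplex_chart_def sum_split
          simp del: One_nat_def)
    show "(\<lambda>p. restrict p {1..<n}) \<in> prob_simplex n \<rightarrow> corner_simplex n"
    proof
      fix p assume p: "p \<in> prob_simplex n"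
      then have "0 \<le> p n" "p n + (\<Sum>i\<in>{1..<n}. p i) = 1"
        using assms by (auto simp: prob_simplex_def sum_split simp del: One_nat_def)
      then show "restrict p {1..<n} \<in> corner_simplex n"
        using p by (auto simp: corner_simplex_def prob_simplex_def)
    qed
    show "restrict (simplex_chart n x) {1..<n} = x" if "x \<in> corner_simplex n" for x
      using that
      by (auto simp: corner_simplex_def simplex_chart_def restrict_def extensional_def fun_eq_iff)
    show "simplex_chart n (restrict p {1..<n}) = p" if p: "p \<in> prob_simplex n" for p
    proof
      fix i
      have "p n + (\<Sum>i\<in>{1..<n}. p i) = 1"
        using p by (auto simp: prob_simplex_def sum_split simp del: One_nat_def)
      then show "simplex_chart n (restrict p {1..<n}) i = p i"
        using p by (cases "i = n")
          (auto simp: prob_simplex_def simplex_chart_def restrict_def extensional_def)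
    qed
  qed
qed

lemma sets_corner_simplex:
  "corner_simplex n \<in> sets (Pi\<^sub>M {1..<n} (\<lambda>_. lborel))"
proof -
  have "corner_simplex n =
      {x \<in> space (Pi\<^sub>M {1..<n} (\<lambda>_. lborel)).
         (\<forall>i\<in>{1..<n}. 0 \<le> x i) \<and> (\<Sum>i\<in>{1..<n}. x i) \<le> 1}"
    by (auto simp: corner_simplex_def space_PiM PiE_def)
  also have "\<dots> \<in> sets (Pi\<^sub>M {1..<n} (\<lambda>_. lborel))"
    by measurable
  finally show ?thesis .
qed

lemma measurable_simplex_chart:
  assumes "n \<ge> 1"
  shows "simplex_chart n \<in>
    measurable (restrict_space (Pi\<^sub>M {1..<n} (\<lambda>_. lborel)) (corner_simplex n))
               (restrict_space (Pi\<^sub>M {1..n} (\<lambda>_. borel)) (prob_simplex n))"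
proof (rule measurable_restrict_space3)
  have "(\<lambda>x. if i < n then x i else 1 - (\<Sum>j\<in>{1..<n}. x j))
      \<in> borel_measurable (Pi\<^sub>M {1..<n} (\<lambda>_. lborel))" if "i \<in> {1..n}" for i
    using that by (cases "i < n") (auto intro!: borel_measurable_diff borel_measurable_sum)
  then show "simplex_chart n \<in> Pi\<^sub>M {1..<n} (\<lambda>_. lborel) \<rightarrow>\<^sub>M Pi\<^sub>M {1..n} (\<lambda>_. borel)"
    unfolding simplex_chart_def by (rule measurable_restrict)
  show "simplex_chart n \<in> corner_simplex n \<rightarrow> prob_simplex n"
    using bij_betw_simplex_chart[OF assms] by (auto simp: bij_betw_def)
qed

lemma space_simplex_volume: "space (simplex_volume n) = prob_simplex n"
  by (auto simp: simplex_volume_def space_restrict_space space_PiM prob_simplex_def PiE_def)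

lemma emeasure_simplex_volume:
  assumes "n \<ge> 1"
  shows "emeasure (simplex_volume n) (prob_simplex n) = 1 / fact (n - 1)"
proof -
  let ?P = "Pi\<^sub>M {1..<n} (\<lambda>_. lborel :: real measure)"
  have sub: "corner_simplex n \<subseteq> space ?P"
    by (auto simp: corner_simplex_def space_PiM PiE_def)
  then have sp: "space (restrict_space ?P (corner_simplex n)) = corner_simplex n"
    by (auto simp: space_restrict_space)
  have "prob_simplex n \<in> sets (restrict_space (Pi\<^sub>M {1..n} (\<lambda>_. borel)) (prob_simplex n))"
    using sets.top[of "simplex_volume n"] unfolding space_simplex_volume
    by (simp add: simplex_volume_def)
  then have "emeasure (simplex_volume n) (prob_simplex n)
      = emeasure (restrict_space ?P (corner_simplex n))
          (simplex_chart n -` prob_simplex n \<inter> corner_simplex n)"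
    unfolding simplex_volume_def using measurable_simplex_chart[OF assms]
    by (subst emeasure_distr) (simp_all add: sp del: One_nat_def)
  also have "simplex_chart n -` prob_simplex n \<inter> corner_simplex n = corner_simplex n"
    using bij_betw_simplex_chart[OF assms] by (auto simp: bij_betw_def)
  also have "emeasure (restrict_space ?P (corner_simplex n)) (corner_simplex n)
      = emeasure ?P (corner_simplex n)"
    using sub sets_corner_simplex[of n]
    by (intro emeasure_restrict_space) (auto simp: Int_absorb2)
  also have "corner_simplex n =
      {x. (\<forall>i\<in>{1..<n}. 0 \<le> x i) \<and> sum x {1..<n} \<le> 1} \<inter> space ?P"
    by (auto simp: corner_simplex_def space_PiM PiE_def)
  also have "emeasure ?P \<dots> = 1 / fact (n - 1)"
    by (subst emeasure_std_simplex_aux)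
       (auto simp: divide_ennreal[symmetric] ennreal_fact)
  finally show ?thesis .
qed

lemma prob_space_uniform_simplex:
  assumes "n \<ge> 1"
  shows "prob_space (uniform_simplex n)"
  unfolding uniform_simplex_def using emeasure_simplex_volume[OF assms]
  by (intro prob_space_uniform_measure) (auto simp: ennreal_divide_eq_top_iff)

lemma space_uniform_simplex: "space (uniform_simplex n) = prob_simplex n"
  by (simp add: uniform_simplex_def space_simplex_volume)

end

theory Submission
  imports Defs
begin

text \<open>
On a line the optimal transport is monotone, so \<open>W1\<close> is the sum over \<open>i < n\<close> of the distances
between the cumulative masses \<open>F\<^sub>i\<close> and \<open>G\<^sub>i\<close> of the two measures (\<open>W1_eq_mass_distance\<close>): every
coupling crosses the cut between \<open>i\<close> and \<open>i + 1\<close> with mass at least \<open>\<bar>F\<^sub>i - G\<^sub>i\<bar>\<close>, and the quantile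
coupling attains all these bounds at once. Put \<open>m = n - 1\<close>. For uniform measures,
\<open>F\<^sub>1 \<le> \<dots> \<le> F\<^sub>m\<close> and \<open>G\<^sub>1 \<le> \<dots> \<le> G\<^sub>m\<close> are two independent uniformly distributed increasing sequences
in \<open>[0,1]\<close>, and the Wasserstein distance is the area between their counting functions.

Merge the two sequences. The order in which \<open>F\<close>-points and \<open>G\<close>-points alternate is a uniformly
random lattice path from \<open>(0,0)\<close> to \<open>(m,m)\<close>; the gaps between consecutive points are independent of
it; and over a gap the counting functions differ by the distance of the path from the diagonal. The
moments of the area are therefore given by weighted counts of lattice paths. This is made precise
for \<open>a\<close> points against \<open>b\<close> points in \<open>[0,T]\<close> by removing the largest of the \<open>a + b\<close> points: if it lies
at \<open>r\<close>, then beyond \<open>r\<close> the counting functions differ by exactly \<open>\<bar>a - b\<bar>\<close>, so that the area is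
\<open>\<bar>a - b\<bar> (T - r)\<close> plus the area for the remaining points in \<open>[0,r]\<close> (\<open>area_remove_last\<close>). The
\<open>k\<close>-th moment is then \<open>T^(a+b+k) / (a+b+k)!\<close> times a number \<open>path_weight k a b\<close> that obeys a recursion
of Pascal type with the source term \<open>k \<bar>a - b\<bar> path_weight (k - 1) a b\<close> (\<open>moment_closed_form\<close>).

It remains to solve this recursion for \<open>k = 2\<close>. For \<open>b \<le> a\<close> the weights with \<open>k = 1\<close> and \<open>k = 2\<close> are
combinations of a binomial coefficient and a binomial tail, with coefficients that are polynomials
in \<open>a + b\<close> and \<open>a - b\<close> (\<open>path_weight_1\<close>, \<open>path_weight_2\<close>). On the diagonal the tail drops out of the
second moment, which is why the answer is a rational function of \<open>n\<close>.
\<close>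

section \<open>Lattice paths weighted by their distance to the diagonal\<close>

text \<open>
The sum, over all lattice paths from \<open>(0,0)\<close> to \<open>(a,b)\<close> with unit steps to the right and up, of
\<open>k!\<close> times the complete homogeneous symmetric polynomial of degree \<open>k\<close> in the numbers \<open>\<bar>i - j\<bar>\<close>, where
\<open>(i,j)\<close> runs through the points of the path. The recursion separates the monomials that do not
contain the factor of the end point from those that do.
\<close>

fun path_weight :: "nat \<Rightarrow> nat \<Rightarrow> nat \<Rightarrow> real" where
  "path_weight k a b =
     (if a = 0 \<and> b = 0 then of_bool (k = 0)
      else (if a = 0 then 0 else path_weight k (a - 1) b)
         + (if b = 0 then 0 else path_weight k a (b - 1))
         + (if k = 0 then 0 else real k * \<bar>real a - real b\<bar> * path_weight (k - 1) a b))"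

declare path_weight.simps [simp del]

lemma path_weight_commute: "path_weight k a b = path_weight k b a"
proof (induction k a b rule: path_weight.induct)
  case (1 k a b)
  then show ?case
    by (subst (1 2) path_weight.simps) (auto simp: abs_minus_commute)
qed

lemma path_weight_0: "path_weight 0 a b = real ((a + b) choose a)"
proof (induction "a + b" arbitrary: a b)
  case 0
  then show ?case by (simp add: path_weight.simps)
next
  case (Suc N)
  show ?case
  proof (cases a; cases b)
    fix a' b' assume ab: "a = Suc a'" "b = Suc b'"
    then have "N = a' + Suc b'" "N = Suc a' + b'" using Suc(2) by auto
    with Suc(1)[of a' b] Suc(1)[of a b'] ab show ?thesis
      by (subst path_weight.simps) simp
  qed (use Suc.hyps(1)[of 0 N] Suc.hyps(1)[of N 0] Suc.hyps(2) in
      \<open>auto simp: path_weight.simps[of 0 "Suc N" 0]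
      path_weight.simps[of 0 0 "Suc N"]\<close>)
qed

text \<open>
With \<open>N = a + b\<close>, a walk of \<open>N\<close> steps \<open>\<plusminus>1\<close> ends at \<open>a - b\<close> in \<open>path_weight 0 a b\<close> cases. The number below
counts the walks that end at or above \<open>a - b\<close> and adds those that end strictly above. In this
symmetric form the tail transforms simply: at the two predecessors of \<open>(a,b)\<close> it is half the sum and
half the difference of the tail and the binomial coefficient at \<open>(a,b)\<close>.
\<close>

definition tail_weight :: "nat \<Rightarrow> nat \<Rightarrow> real" where
  "tail_weight a b = (\<Sum>i=a..a+b. real ((a + b) choose i)) + (\<Sum>i=Suc a..a+b. real ((a + b) choose i))"

lemma sum_choose_Suc:
  "(\<Sum>i=Suc l..Suc N. real (Suc N choose i))
     = (\<Sum>i=l..N. real (N choose i)) + (\<Sum>i=Suc l..N. real (N choose i))"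
proof -
  have "(\<Sum>i=Suc l..Suc N. real (Suc N choose i)) = (\<Sum>i=l..N. real (Suc N choose Suc i))"
    by (rule sum.shift_bounds_cl_Suc_ivl)
  also have "\<dots> = (\<Sum>i=l..N. real (N choose i)) + (\<Sum>i=l..N. real (N choose Suc i))"
    by (simp add: sum.distrib)
  also have "(\<Sum>i=l..N. real (N choose Suc i)) = (\<Sum>i=Suc l..Suc N. real (N choose i))"
    by (rule sum.shift_bounds_cl_Suc_ivl[symmetric])
  also have "\<dots> = (\<Sum>i=Suc l..N. real (N choose i))"
    by (cases "l \<le> N") auto
  finally show ?thesis .
qed

lemma tail_weight_0: "tail_weight a 0 = 1"
  by (simp add: tail_weight_def)

lemma tail_weight_pred_left:
  "tail_weight a b = (tail_weight (Suc a) b + path_weight 0 (Suc a) b) / 2"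
proof -
  have "tail_weight a b = (\<Sum>i=Suc a..Suc (a + b). real (Suc (a+b) choose i))"
    unfolding sum_choose_Suc tail_weight_def ..
  moreover have "(\<Sum>i=Suc a..Suc (a + b). real (Suc (a+b) choose i)) =
     real (Suc (a + b) choose Suc a) + (\<Sum>i=Suc (Suc a)..Suc (a+b). real (Suc (a+b) choose i))"
    by (subst sum.atLeast_Suc_atMost) auto
  ultimately show ?thesis by (simp add: tail_weight_def[of "Suc a"] path_weight_0 del: binomial_Suc_Suc)
qed

lemma tail_weight_pred_right:
  assumes "b \<le> a"
  shows "tail_weight a b = (tail_weight a (Suc b) - path_weight 0 a (Suc b)) / 2"
proof -
  have "tail_weight a b = (\<Sum>i=Suc a..Suc (a + b). real (Suc (a+b) choose i))"
    unfolding sum_choose_Suc tail_weight_def ..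
  moreover have "(\<Sum>i=a..Suc (a + b). real (Suc (a+b) choose i)) =
     real (Suc (a + b) choose a) + (\<Sum>i=Suc a..Suc (a+b). real (Suc (a+b) choose i))"
    by (subst sum.atLeast_Suc_atMost) auto
  ultimately show ?thesis by (simp add: tail_weight_def[of a "Suc b"] path_weight_0 del: binomial_Suc_Suc)
qed

lemma path_weight_0_pred_left:
  "real (Suc a + b) * path_weight 0 a b = real (Suc a) * path_weight 0 (Suc a) b"
  using Suc_times_binomial[of a "a + b"] unfolding path_weight_0
  by (metis add_Suc of_nat_mult mult.commute)

lemma path_weight_0_pred_right:
  "real (a + Suc b) * path_weight 0 a b = real (Suc b) * path_weight 0 a (Suc b)"
  using path_weight_0_pred_left[of b a] by (simp add: path_weight_commute[of 0] add.commute)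

text \<open>
The closed forms in the variables \<open>N = a + b\<close>, \<open>x = a - b\<close>, \<open>p = path_weight 0 a b\<close> and
\<open>s = tail_weight a b\<close>. Passing to a predecessor of \<open>(a,b)\<close> acts linearly on \<open>(p,s)\<close>, with coefficients
rational in \<open>N\<close> and \<open>x\<close>; this suggests solutions that are linear in \<open>p\<close> and \<open>s\<close> with polynomial
coefficients, and comparing finitely many values of the recursion determines these polynomials.
\<close>

definition first_closed :: "real \<Rightarrow> real \<Rightarrow> real \<Rightarrow> real \<Rightarrow> real" where
  "first_closed N x p s = ((N + x^2) * s + x * (N + 1) * p) / 4"

definition second_closed :: "real \<Rightarrow> real \<Rightarrow> real \<Rightarrow> real \<Rightarrow> real" where
  "second_closed N x p s =
     ((N + 1) * (4 * x^4 + (21 * N + 22) * x^2 + 7 * N^2 + 6 * N) * p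
       - 2 * x * (x^2 - 1) * (2 * x^2 + 5 * N + 2) * s) / 60"

lemma first_step:
  assumes "N \<noteq> 0"
  shows "first_closed N x p s = first_closed (N-1) (x-1) ((N+x)/(2*N)*p) ((s+p)/2)
     + first_closed (N-1) (x+1) ((N-x)/(2*N)*p) ((s-p)/2) + x * p"
  using assms unfolding first_closed_def
  by (simp add: field_simps) algebra

lemma second_step:
  assumes "N \<noteq> 0"
  shows "second_closed N x p s = second_closed (N-1) (x-1) ((N+x)/(2*N)*p) ((s+p)/2)
     + second_closed (N-1) (x+1) ((N-x)/(2*N)*p) ((s-p)/2) + 2 * x * first_closed N x p s"
  using assms unfolding second_closed_def first_closed_def
  by (simp add: field_simps) algebra

text \<open>
A criterion for a function \<open>f\<close> to solve the recursion on \<open>b \<le> a\<close>, if \<open>g\<close> describes the weights of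
degree \<open>k - 1\<close>. Assumption \<open>step\<close> is the recursion itself, written without the absolute value. Two
boundaries need care. For \<open>b = 0\<close> the predecessor \<open>(a,-1)\<close> is absent; its parameters \<open>p\<close> and \<open>s\<close> both
come out as \<open>0\<close>, so \<open>edge\<close> suffices. For \<open>a = b\<close> the predecessor \<open>(a-1,a)\<close> lies on the far side of the
diagonal, where the weight is known by symmetry only; \<open>reflect\<close> says that \<open>f\<close>, continued formally
to \<open>x = -1\<close>, takes the symmetric value there.
\<close>

lemma path_weight_closed_form:
  fixes f g :: "real \<Rightarrow> real \<Rightarrow> real \<Rightarrow> real \<Rightarrow> real"
  assumes "k > 0"
    and step: "\<And>N x p s. N \<noteq> 0 \<Longrightarrow> f N x p s =
        f (N - 1) (x - 1) ((N + x) / (2 * N) * p) ((s + p) / 2)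
      + f (N - 1) (x + 1) ((N - x) / (2 * N) * p) ((s - p) / 2) + k * x * g N x p s"
    and edge: "\<And>N x. f N x 0 0 = 0"
    and origin: "\<And>p s. f 0 0 p s = 0"
    and reflect: "\<And>N p s. f N (-1) p (s + 2 * p) = f N 1 p s"
    and lower: "\<And>a b. b \<le> a \<Longrightarrow> path_weight (k - 1) a b
      = g (real a + real b) (real a - real b) (path_weight 0 a b) (tail_weight a b)"
  shows "b \<le> a \<Longrightarrow> path_weight k a b
      = f (real a + real b) (real a - real b) (path_weight 0 a b) (tail_weight a b)"
proof (induction "a + b" arbitrary: a b)
  case 0
  with \<open>k > 0\<close> origin show ?case by (simp add: path_weight.simps)
next
  case (Suc M)
  define N x p s where "N = real a + real b" and "x = real a - real b"
    and "p = path_weight 0 a b" and "s = tail_weight a b"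
  have N: "N \<noteq> 0" using Suc.hyps(2) by (auto simp: N_def)
  from Suc obtain a' where a: "a = Suc a'" by (cases a) auto
  have "N + x = 2 * real a" "N - x = 2 * real b"
    by (simp_all add: N_def x_def)
  then have half: "(N + x) / (2 * N) * p = real a * p / N" "(N - x) / (2 * N) * p = real b * p / N"
    by simp_all
  have left: "path_weight 0 a' b = (N + x) / (2 * N) * p" "tail_weight a' b = (s + p) / 2"
    using path_weight_0_pred_left[of a' b] tail_weight_pred_left[of a' b] N unfolding half
    by (simp_all add: a N_def p_def s_def eq_divide_eq ac_simps)
  \<comment> \<open>The predecessor with one step up fewer; at the edge its contribution vanishes.\<close>
  have right: "(if b = 0 then 0 else path_weight k a (b - 1))
      = f (N - 1) (x + 1) ((N - x) / (2 * N) * p) ((s - p) / 2)"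
  proof (cases b)
    case 0
    then show ?thesis
      using edge by (simp add: N_def x_def p_def s_def path_weight_0 tail_weight_0)
  next
    case (Suc b')
    have right: "path_weight 0 a b' = (N - x) / (2 * N) * p" "tail_weight a b' = (s - p) / 2"
      using path_weight_0_pred_right[of a b'] tail_weight_pred_right[of b' a] N Suc \<open>b \<le> a\<close>
      unfolding half
      by (simp_all add: N_def p_def s_def eq_divide_eq ac_simps)
    have "real a + real b' = N - 1" "real a - real b' = x + 1"
      by (simp_all add: N_def x_def Suc)
    then show ?thesis
      using Suc.hyps(1)[of a b'] Suc \<open>Suc M = a + b\<close> \<open>b \<le> a\<close> unfolding right by simp
  qed
  \<comment> \<open>The predecessor with one step to the right fewer; on the diagonal it is the mirror image of the other one.\<close>
  have left': "path_weight k a' b = f (N - 1) (x - 1) ((N + x) / (2 * N) * p) ((s + p) / 2)"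
  proof (cases "b = a")
    case False
    moreover have "real a' + real b = N - 1" "real a' - real b = x - 1"
      by (simp_all add: N_def x_def a)
    ultimately show ?thesis
      using Suc.hyps(1)[of a' b] Suc.hyps(2) Suc.prems a unfolding left by simp
  next
    case True
    have "path_weight k a' b = f (N - 1) 1 (p / 2) ((s - p) / 2)"
    proof -
      have "(N - x) / (2 * N) * p = p / 2" "x = 0" "b = Suc a'"
        using True N a by (simp_all add: x_def)
      then show ?thesis using right a N by (simp add: path_weight_commute[of k a'])
    qed
    also have "\<dots> = f (N - 1) (-1) (p / 2) ((s - p) / 2 + 2 * (p / 2))"
      by (rule reflect[symmetric])
    also have "(s - p) / 2 + 2 * (p / 2) = (s + p) / 2" by (simp add: field_simps)
    finally show ?thesis using True N by (simp add: x_def)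
  qed
  have "path_weight k a b = path_weight k a' b + (if b = 0 then 0 else path_weight k a (b - 1))
      + k * x * g N x p s"
    using \<open>k > 0\<close> lower[OF Suc.prems] Suc.prems
    by (subst path_weight.simps) (simp add: a N_def x_def p_def s_def)
  then show ?case
    unfolding right left' using step[OF N] by (simp add: N_def x_def p_def s_def)
qed

lemma path_weight_1:
  assumes "b \<le> a"
  shows "path_weight 1 a b
    = first_closed (real a + real b) (real a - real b) (path_weight 0 a b) (tail_weight a b)"
  by (rule path_weight_closed_form[where g = "\<lambda>N x p s. p", OF _ _ _ _ _ _ assms])
     (use first_step in \<open>auto simp: first_closed_def algebra_simps\<close>)

lemma path_weight_2:
  assumes "b \<le> a"
  shows "path_weight 2 a b
    = second_closed (real a + real b) (real a - real b) (path_weight 0 a b) (tail_weight a b)"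
  by (rule path_weight_closed_form[where g = first_closed, OF _ _ _ _ _ _ assms])
     (use second_step path_weight_1 in \<open>auto simp: second_closed_def\<close>)

text \<open>
For \<open>x = 0\<close> the factor \<open>x\<close> in front of the tail removes it.
\<close>

lemma path_weight_2_diagonal:
  "path_weight 2 m m = real ((2 * m) choose m) * m * (2 * m + 1) * (7 * m + 3) / 15"
  unfolding path_weight_2[OF order_refl] second_closed_def path_weight_0
  by (simp add: mult_2[symmetric] field_simps power2_eq_square)

lemma path_weight_nonneg: "0 \<le> path_weight k a b"
  by (induction k a b rule: path_weight.induct) (subst path_weight.simps, simp)

text \<open>
Eliminating the source term: the weights at \<open>(a,b)\<close> are expressed by those at its predecessors
alone. In this form the recursion will match the binomial expansion of a power of the area.
\<close>

lemma path_weight_unroll: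
  assumes "a > 0 \<or> b > 0"
  shows "path_weight k a b = (\<Sum>i\<le>k. fact k / fact i * \<bar>real a - real b\<bar> ^ (k - i)
      * ((if a = 0 then 0 else path_weight i (a - 1) b) + (if b = 0 then 0 else path_weight i a (b - 1))))"
proof (induction k)
  case 0
  show ?case using assms by (subst path_weight.simps) auto
next
  case (Suc k)
  have "path_weight (Suc k) a b =
      ((if a = 0 then 0 else path_weight (Suc k) (a - 1) b) + (if b = 0 then 0 else path_weight (Suc k) a (b - 1)))
      + real (Suc k) * \<bar>real a - real b\<bar> * path_weight k a b"
    using assms by (subst path_weight.simps) auto
  then show ?case
    unfolding Suc sum_distrib_left by (auto simp: Suc_diff_le mult_ac intro!: sum.cong)
qed

text \<open>
Each of the two uniform distributions contributes a factor \<open>m!\<close>, the reciprocal of the volume of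
its simplex.
\<close>

lemma path_weight_2_normalized:
  "fact m * (fact m * (path_weight 2 m m / fact (m + m + 2))) = real m * (7 * m + 3) / (30 * (m + 1))"
proof -
  have choose: "real (2 * m choose m) = fact (2 * m) / (fact m * fact m)"
    using binomial_fact[of m "2 * m", where ?'a = real] by simp
  have "fact (m + m + 2) = fact (Suc (Suc (2 * m)))" by (simp only: mult_2 add_2_eq_Suc')
  also have "\<dots> = (2 * real m + 2) * ((2 * real m + 1) * fact (2 * m))"
    unfolding fact_Suc by (simp add: algebra_simps)
  finally have fact: "fact (m + m + 2) = (2 * real m + 2) * ((2 * real m + 1) * fact (2 * m))" .
  have cancel: "A * (A * (F / (A * A) * p * k * q / 15 / ((2 * c) * (k * F)))) = p * q / (30 * c)"
    if "A \<noteq> 0" "F \<noteq> 0" "k \<noteq> 0" "c \<noteq> 0" for A F k c p q :: real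
    using that by (simp add: field_simps)
  have "path_weight 2 m m = fact (2 * m) / (fact m * fact m) * real m * (2 * real m + 1) * (7 * real m + 3) / 15"
    unfolding path_weight_2_diagonal choose by simp
  moreover have "2 * real m + 2 = 2 * (real m + 1)" by simp
  moreover have "2 * real m + 1 \<noteq> 0" "real m + 1 \<noteq> 0" by linarith+
  ultimately show ?thesis
    unfolding fact using cancel[of "fact m" "fact (2 * m)" "2 * real m + 1" "real m + 1" "real m" "7 * real m + 3"]
    by simp
qed

section \<open>Partial sums as coordinates on a simplex\<close>

abbreviation lborel_power :: "nat \<Rightarrow> (nat \<Rightarrow> real) measure" where
  "lborel_power a \<equiv> Pi\<^sub>M {1..a} (\<lambda>_. lborel)"

interpretation lborel_product: product_sigma_finite "\<lambda>_::nat. lborel :: real measure"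
  by standard

lemma sigma_finite_lborel_power: "sigma_finite_measure (lborel_power a)"
  by (rule lborel_product.sigma_finite) simp

text \<open>
The change of variables from the last increment to the last partial sum is a shear, so it preserves
Lebesgue measure. It brings the largest point \<open>r\<close> of an increasing sequence to the outside.
\<close>

lemma nn_integral_last_partial_sum:
  assumes [measurable]: "g \<in> borel_measurable (lborel_power (Suc a))"
  shows "(\<integral>\<^sup>+x. g x \<partial>lborel_power (Suc a))
       = (\<integral>\<^sup>+r. \<integral>\<^sup>+x. g (x(Suc a := r - sum x {1..a})) \<partial>lborel_power a \<partial>lborel)"
proof -
  interpret pair_sigma_finite "lborel_power a" "lborel :: real measure"
    by (intro pair_sigma_finite.intro sigma_finite_lborel_power lborel.sigma_finite_measure_axioms)
  have ins: "{1..Suc a} = insert (Suc a) {1..a}" by auto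
  have g: "g \<in> borel_measurable (Pi\<^sub>M (insert (Suc a) {1..a}) (\<lambda>_. lborel))"
    using assms unfolding ins .
  have upd: "(\<lambda>(x, r). g (x(Suc a := h x r))) \<in> borel_measurable (lborel_power a \<Otimes>\<^sub>M lborel)"
    if [measurable]: "(\<lambda>(x, r). h x r) \<in> borel_measurable (lborel_power a \<Otimes>\<^sub>M lborel)"
    for h :: "(nat \<Rightarrow> real) \<Rightarrow> real \<Rightarrow> real"
  proof -
    have "(\<lambda>z. h (fst z) (snd z)) \<in> borel_measurable (lborel_power a \<Otimes>\<^sub>M lborel)"
      using that by (simp add: split_beta')
    then show ?thesis
      unfolding split_beta'
      by (intro measurable_compose[OF _ g] measurable_fun_upd[where J = "{1..a}"]) auto
  qed
  have "(\<integral>\<^sup>+x. g x \<partial>lborel_power (Suc a))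
      = (\<integral>\<^sup>+x. \<integral>\<^sup>+y. g (x(Suc a := y)) \<partial>lborel \<partial>lborel_power a)"
    unfolding ins by (rule lborel_product.product_nn_integral_insert) (use g in auto)
  also have "\<dots> = (\<integral>\<^sup>+x. \<integral>\<^sup>+r. g (x(Suc a := r - sum x {1..a})) \<partial>lborel \<partial>lborel_power a)"
  proof (rule nn_integral_cong)
    fix x assume x: "x \<in> space (lborel_power a)"
    have "(\<lambda>y. g (x(Suc a := y))) \<in> borel_measurable borel"
      using measurable_compose[OF measurable_component_update[OF x] g] by simp
    from nn_integral_real_affine[OF this, of 1 "- sum x {1..a}"]
    show "(\<integral>\<^sup>+y. g (x(Suc a := y)) \<partial>lborel)
        = (\<integral>\<^sup>+r. g (x(Suc a := r - sum x {1..a})) \<partial>lborel)"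
      by simp
  qed
  also have "\<dots> = (\<integral>\<^sup>+r. \<integral>\<^sup>+x. g (x(Suc a := r - sum x {1..a})) \<partial>lborel_power a \<partial>lborel)"
    by (rule Fubini'[symmetric], rule upd) measurable
  finally show ?thesis .
qed

definition steps :: "nat \<Rightarrow> real \<Rightarrow> (nat \<Rightarrow> real) set" where
  "steps a T = {x. (\<forall>i\<in>{1..a}. 0 \<le> x i) \<and> sum x {1..a} \<le> T}"

text \<open>
The points of a sequence are the partial sums of its increments. A sequence of \<open>a\<close> points in
\<open>[0,T]\<close> is prolonged by the constant \<open>T\<close>. With this convention the sum in \<open>area\<close> below is the area
over \<open>[0,T]\<close> between the two counting functions also when the sequences have different lengths.
\<close>

definition level :: "nat \<Rightarrow> real \<Rightarrow> (nat \<Rightarrow> real) \<Rightarrow> nat \<Rightarrow> real" where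
  "level a T x i = (if i \<le> a then sum x {1..i} else T)"

definition area :: "nat \<Rightarrow> nat \<Rightarrow> real \<Rightarrow> (nat \<Rightarrow> real) \<Rightarrow> (nat \<Rightarrow> real) \<Rightarrow> real" where
  "area a b T x y = (\<Sum>i=1..max a b. \<bar>level a T x i - level b T y i\<bar>)"

lemma area_nonneg: "0 \<le> area a b T x y"
  by (simp add: area_def sum_nonneg)

lemma area_commute: "area a b T x y = area b a T y x"
  by (simp add: area_def max.commute abs_minus_commute)

lemma level_measurable [measurable]:
  assumes [measurable]: "f \<in> N \<rightarrow>\<^sub>M lborel_power a"
  shows "(\<lambda>z. level a T (f z) i) \<in> borel_measurable N"
proof (cases "i \<le> a")
  case True
  have "(\<lambda>z. f z j) \<in> borel_measurable N" if "j \<in> {1..i}" for j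
    using measurable_compose[OF assms measurable_component_singleton[of j]] that True by simp
  then show ?thesis using True by (simp add: level_def borel_measurable_sum)
qed (simp add: level_def)

lemma total_measurable [measurable]:
  assumes [measurable]: "f \<in> N \<rightarrow>\<^sub>M lborel_power a"
  shows "(\<lambda>z. sum (f z) {1..a}) \<in> borel_measurable N"
  using level_measurable[OF assms, of T a] by (simp add: level_def)

lemma area_measurable [measurable]:
  assumes [measurable]: "f \<in> N \<rightarrow>\<^sub>M lborel_power a" "g \<in> N \<rightarrow>\<^sub>M lborel_power b"
  shows "(\<lambda>z. area a b T (f z) (g z)) \<in> borel_measurable N"
  unfolding area_def by measurable

lemma steps_measurable [measurable]:
  assumes [measurable]: "f \<in> N \<rightarrow>\<^sub>M lborel_power a" "T \<in> borel_measurable N"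
  shows "Measurable.pred N (\<lambda>z. f z \<in> steps a (T z))"
proof -
  have "(\<lambda>z. f z j) \<in> borel_measurable N" if "j \<in> {1..a}" for j
    using measurable_compose[OF assms(1) measurable_component_singleton[of j]] that by simp
  then have [measurable]: "Measurable.pred N (\<lambda>z. \<forall>j\<in>{1..a}. 0 \<le> f z j)"
    by (intro pred_intros_finite) auto
  show ?thesis unfolding steps_def mem_Collect_eq by measurable
qed

lemma sum_le_of_steps:
  assumes "x \<in> steps a r" "i \<le> a" shows "sum x {1..i} \<le> r"
proof -
  have "sum x {1..i} \<le> sum x {1..a}"
    using assms by (intro sum_mono2) (auto simp: steps_def)
  then show ?thesis using assms by (auto simp: steps_def)
qed

lemma sum_nonneg_steps: "x \<in> steps a r \<Longrightarrow> 0 \<le> sum x {1..a}"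
  by (auto simp: steps_def intro: sum_nonneg)

text \<open>
Both sequences lie in \<open>[0,r]\<close>, and \<open>r\<close> is added as last point of the first one. Lowering the end point
of the interval from \<open>T\<close> to \<open>r\<close> changes a term of the area only if exactly one of the two sequences
is still running at this index, and then by \<open>T - r\<close>. The new point itself sits at the value which the first sequence was prolonged on \<open>[0,r]\<close>.
\<close>

lemma area_remove_last:
  assumes x: "x \<in> steps a r" and y: "y \<in> steps b r" and "r \<le> T"
  shows "area (Suc a) b T (x(Suc a := r - sum x {1..a})) y
       = area a b r x y + \<bar>real (Suc a) - real b\<bar> * (T - r)"
proof -
  define x' where "x' = x(Suc a := r - sum x {1..a})"
  let ?I = "{1..max (Suc a) b}"
  let ?D = "{min (Suc a) b<..max (Suc a) b}"
  have sum_x': "sum x' {1..i} = (if i \<le> a then sum x {1..i} else r)" if "i \<le> Suc a" for i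
  proof (cases "i \<le> a")
    case False
    with that have "i = Suc a" by simp
    moreover have "sum x' {1..a} = sum x {1..a}" by (intro sum.cong) (auto simp: x'_def)
    ultimately show ?thesis by (simp add: x'_def)
  qed (auto simp: x'_def intro!: sum.cong)
  \<comment> \<open>The indices in \<open>?D\<close> are those at which exactly one of the two sequences has run out.\<close>
  have "\<bar>level (Suc a) T x' i - level b T y i\<bar>
      = \<bar>level a r x i - level b r y i\<bar> + (if i \<in> ?D then T - r else 0)" if "i \<in> ?I" for i
    using sum_le_of_steps[OF x, of i] sum_le_of_steps[OF y, of i] \<open>r \<le> T\<close> sum_x'[of i] that
    by (auto simp: level_def split: if_splits)
  then have "area (Suc a) b T x' y = (\<Sum>i\<in>?I. \<bar>level a r x i - level b r y i\<bar>)
      + (\<Sum>i\<in>?I. if i \<in> ?D then T - r else 0)"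
    unfolding area_def sum.distrib[symmetric] by (intro sum.cong refl)
  also have "(\<Sum>i\<in>?I. if i \<in> ?D then T - r else 0) = (\<Sum>i\<in>?D. T - r)"
  proof -
    have "?I \<inter> ?D = ?D" by auto
    then show ?thesis by (subst sum.inter_restrict[symmetric]) auto
  qed
  also have "\<dots> = \<bar>real (Suc a) - real b\<bar> * (T - r)"
    by (cases "Suc a \<le> b") (auto simp: max_def min_def of_nat_diff)
  also have "(\<Sum>i\<in>?I. \<bar>level a r x i - level b r y i\<bar>) = area a b r x y"
    unfolding area_def by (intro sum.mono_neutral_right) (auto simp: level_def)
  finally show ?thesis unfolding x'_def .
qed

lemma sum_upd_last: "sum (x(Suc a := r - sum x {1..a})) {1..Suc a} = (r :: real)"
proof -
  have "sum (x(Suc a := r - sum x {1..a})) {1..a} = sum x {1..a}" by (intro sum.cong) auto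
  then show ?thesis by simp
qed

text \<open>
Once the last partial sum is a coordinate, the set in question is a hyperplane on which a coordinate
is constant.
\<close>

lemma AE_total_neq:
  assumes "a > 0" shows "AE x in lborel_power a. sum x {1..a} \<noteq> c"
proof -
  obtain a' where a: "a = Suc a'" using assms by (cases a) auto
  let ?g = "\<lambda>x. indicator {x. sum x {1..Suc a'} = c} x :: ennreal"
  have [measurable]: "?g \<in> borel_measurable (lborel_power (Suc a'))"
    unfolding indicator_def mem_Collect_eq by measurable
  have "(\<integral>\<^sup>+x. ?g x \<partial>lborel_power (Suc a')) = (\<integral>\<^sup>+r. \<integral>\<^sup>+x. indicator {c} r \<partial>lborel_power a' \<partial>lborel)"
    by (subst nn_integral_last_partial_sum)
       (measurable, simp only: indicator_def mem_Collect_eq sum_upd_last singleton_iff)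
  also have "\<dots> = (\<integral>\<^sup>+r. 0 \<partial>(lborel :: real measure))"
    using AE_lborel_singleton[of c] by (intro nn_integral_cong_AE) (auto elim!: eventually_mono)
  finally have "AE x in lborel_power (Suc a'). ?g x = 0"
    by (intro nn_integral_0_iff_AE[THEN iffD1]) auto
  then show ?thesis unfolding a by eventually_elim (auto simp: indicator_def split: if_splits)
qed

section \<open>Moments of the area between two increasing sequences\<close>

lemma indicator_steps_measurable [measurable]:
  assumes [measurable]: "f \<in> N \<rightarrow>\<^sub>M lborel_power a" "T \<in> borel_measurable N"
  shows "(\<lambda>z. indicator (steps a (T z)) (f z) :: ennreal) \<in> borel_measurable N"
  by (rule borel_measurable_indicator') measurable

lemma AE_totals_neq:
  assumes "a > 0 \<or> b > 0"
  shows "AE x in lborel_power a. AE y in lborel_power b. sum x {1..a} \<noteq> sum y {1..b}"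
proof (cases "b > 0")
  case True
  have "AE y in lborel_power b. sum x {1..a} \<noteq> sum y {1..b}" for x :: "nat \<Rightarrow> real"
    using AE_total_neq[OF True, of "sum x {1..a}"] by (rule eventually_mono) auto
  then show ?thesis by simp
next
  case False
  with assms AE_total_neq[of a 0] have "AE x in lborel_power a. sum x {1..a} \<noteq> 0" by simp
  then show ?thesis using False by (auto elim: eventually_mono)
qed

text \<open>
The unnormalised \<open>k\<close>-th moment of the area between \<open>a\<close> and \<open>b\<close> increasing points in \<open>[0,T]\<close>, and the
part of it in which the first sequence has the largest point: then the points of the second
one are confined to \<open>[0, sum x {1..a}]\<close>.
\<close>

definition moment :: "nat \<Rightarrow> nat \<Rightarrow> nat \<Rightarrow> real \<Rightarrow> ennreal" where
  "moment k a b T = (\<integral>\<^sup>+x. \<integral>\<^sup>+y. indicator (steps a T) x * indicator (steps b T) y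
     * ennreal (area a b T x y ^ k) \<partial>lborel_power b \<partial>lborel_power a)"

definition dominated_moment :: "nat \<Rightarrow> nat \<Rightarrow> nat \<Rightarrow> real \<Rightarrow> ennreal" where
  "dominated_moment k a b T = (\<integral>\<^sup>+x. \<integral>\<^sup>+y. indicator (steps a T) x * indicator (steps b (sum x {1..a})) y
     * ennreal (area a b T x y ^ k) \<partial>lborel_power b \<partial>lborel_power a)"

text \<open>
The largest of all points belongs to the first or to the second sequence; ties form a null set
unless both sequences are empty.
\<close>

lemma moment_split:
  assumes "a > 0 \<or> b > 0"
  shows "moment k a b T = dominated_moment k a b T + dominated_moment k b a T"
proof -
  interpret pair_sigma_finite "lborel_power a" "lborel_power b"
    by (intro pair_sigma_finite.intro sigma_finite_lborel_power)
  let ?f = "\<lambda>x y. indicator (steps a T) x * indicator (steps b (sum x {1..a})) y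
     * ennreal (area a b T x y ^ k)"
  let ?g = "\<lambda>x y. indicator (steps b T) y * indicator (steps a (sum y {1..b})) x
     * ennreal (area a b T x y ^ k)"
  have f [measurable]: "case_prod ?f \<in> borel_measurable (lborel_power a \<Otimes>\<^sub>M lborel_power b)"
    and g [measurable]: "case_prod ?g \<in> borel_measurable (lborel_power a \<Otimes>\<^sub>M lborel_power b)"
    by measurable
  have fx: "?f x \<in> borel_measurable (lborel_power b)" and gx: "?g x \<in> borel_measurable (lborel_power b)"
    if x: "x \<in> space (lborel_power a)" for x
    using measurable_compose[OF measurable_Pair1'[OF x] f] measurable_compose[OF measurable_Pair1'[OF x] g]
    by simp_all
  have "moment k a b T = (\<integral>\<^sup>+x. \<integral>\<^sup>+y. ?f x y + ?g x y \<partial>lborel_power b \<partial>lborel_power a)"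
    unfolding moment_def
  proof (rule nn_integral_cong_AE, use AE_totals_neq[OF assms] in eventually_elim)
    fix x :: "nat \<Rightarrow> real"
    assume "AE y in lborel_power b. sum x {1..a} \<noteq> sum y {1..b}"
    then show "(\<integral>\<^sup>+y. indicator (steps a T) x * indicator (steps b T) y
        * ennreal (area a b T x y ^ k) \<partial>lborel_power b)
      = (\<integral>\<^sup>+y. ?f x y + ?g x y \<partial>lborel_power b)"
    proof (intro nn_integral_cong_AE, elim eventually_mono)
      fix y assume "sum x {1..a} \<noteq> sum y {1..b}"
      then show "indicator (steps a T) x * indicator (steps b T) y * ennreal (area a b T x y ^ k)
          = ?f x y + ?g x y"
        by (cases "x \<in> steps a T"; cases "y \<in> steps b T")
           (auto simp: indicator_def steps_def)
    qed
  qed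
  also have "\<dots> = (\<integral>\<^sup>+x. (\<integral>\<^sup>+y. ?f x y \<partial>lborel_power b) + (\<integral>\<^sup>+y. ?g x y \<partial>lborel_power b) \<partial>lborel_power a)"
    by (rule nn_integral_cong, rule nn_integral_add[OF fx gx])
  also have "\<dots> = (\<integral>\<^sup>+x. (\<integral>\<^sup>+y. ?f x y \<partial>lborel_power b) \<partial>lborel_power a)
      + (\<integral>\<^sup>+x. (\<integral>\<^sup>+y. ?g x y \<partial>lborel_power b) \<partial>lborel_power a)"
    by (rule nn_integral_add[OF M2.borel_measurable_nn_integral_fst[OF f, unfolded split_conv] M2.borel_measurable_nn_integral_fst[OF g, unfolded split_conv]])
  also have "(\<integral>\<^sup>+x. (\<integral>\<^sup>+y. ?g x y \<partial>lborel_power b) \<partial>lborel_power a) = dominated_moment k b a T"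
    unfolding dominated_moment_def area_commute[of b a]
    by (rule Fubini'[OF g, symmetric])
  finally show ?thesis by (simp add: dominated_moment_def)
qed

text \<open>
An empty sequence cannot own the largest point.
\<close>

lemma dominated_moment_0:
  assumes "b > 0" shows "dominated_moment k 0 b T = 0"
proof -
  have "dominated_moment k 0 b T = (\<integral>\<^sup>+x. \<integral>\<^sup>+y. 0 \<partial>lborel_power b \<partial>lborel_power 0)"
    unfolding dominated_moment_def
  proof (rule nn_integral_cong, rule nn_integral_cong_AE)
    fix x :: "nat \<Rightarrow> real"
    show "AE y in lborel_power b. indicator (steps 0 T) x * indicator (steps b (sum x {1..0})) y
      * ennreal (area 0 b T x y ^ k) = 0"
      using AE_total_neq[OF assms, of 0]
    proof (rule eventually_mono)
      fix y :: "nat \<Rightarrow> real" assume "sum y {1..b} \<noteq> 0"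
      then have "y \<notin> steps b 0" using sum_nonneg_steps[of y b 0] by (auto simp: steps_def)
      then show "indicator (steps 0 T) x * indicator (steps b (sum x {1..0})) y
        * ennreal (area 0 b T x y ^ k) = 0" by simp
    qed
  qed
  then show ?thesis by simp
qed

text \<open>
With the largest point \<open>r\<close> integrated last, the area becomes the area of the remaining points in
\<open>[0,r]\<close> plus a constant.
\<close>

lemma dominated_moment_Suc:
  "dominated_moment k (Suc a) b T =
    (\<integral>\<^sup>+r. indicator {0..T} r * (\<integral>\<^sup>+x. \<integral>\<^sup>+y. indicator (steps a r) x * indicator (steps b r) y
       * ennreal ((area a b r x y + \<bar>real (Suc a) - real b\<bar> * (T - r)) ^ k)
       \<partial>lborel_power b \<partial>lborel_power a) \<partial>lborel)"
proof -
  interpret B: sigma_finite_measure "lborel_power b"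
    by (rule sigma_finite_lborel_power)
  let ?f = "\<lambda>x y. indicator (steps (Suc a) T) x * indicator (steps b (sum x {1..Suc a})) y
     * ennreal (area (Suc a) b T x y ^ k)"
  have "(\<lambda>(x, y). ?f x y) \<in> borel_measurable (lborel_power (Suc a) \<Otimes>\<^sub>M lborel_power b)"
    by measurable
  then have "(\<lambda>x. \<integral>\<^sup>+y. ?f x y \<partial>lborel_power b) \<in> borel_measurable (lborel_power (Suc a))"
    by (rule B.borel_measurable_nn_integral)
  note nn_integral_last_partial_sum[OF this]
  moreover have "?f (x(Suc a := r - sum x {1..a})) y = indicator {0..T} r *
      (indicator (steps a r) x * indicator (steps b r) y
       * ennreal ((area a b r x y + \<bar>real (Suc a) - real b\<bar> * (T - r)) ^ k))" for x y r
  proof -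
    have "x(Suc a := r - sum x {1..a}) \<in> steps (Suc a) T \<longleftrightarrow> x \<in> steps a r \<and> r \<in> {0..T}"
    proof -
      have "x(Suc a := r - sum x {1..a}) \<in> steps (Suc a) T \<longleftrightarrow> x \<in> steps a r \<and> r \<le> T"
        unfolding steps_def mem_Collect_eq sum_upd_last
        by (auto simp: le_Suc_eq)
      then show ?thesis using sum_nonneg_steps[of x a r] by (auto simp: steps_def)
    qed
    then show ?thesis
      unfolding sum_upd_last
      by (auto simp: indicator_def area_remove_last simp del: fun_upd_apply One_nat_def of_nat_Suc)
  qed
  moreover have "(\<integral>\<^sup>+x. \<integral>\<^sup>+y. indicator {0..T} r * h x y \<partial>lborel_power b \<partial>lborel_power a)
     = indicator {0..T} r * (\<integral>\<^sup>+x. \<integral>\<^sup>+y. h x y \<partial>lborel_power b \<partial>lborel_power a)"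
    for r :: real and h :: "(nat \<Rightarrow> real) \<Rightarrow> (nat \<Rightarrow> real) \<Rightarrow> ennreal"
    by (auto simp: indicator_def)
  ultimately show ?thesis unfolding dominated_moment_def by simp
qed

lemma borel_measurable_moment_integrand [measurable]:
  "(\<lambda>x. \<integral>\<^sup>+y. indicator (steps a r) x * indicator (steps b r) y * ennreal (area a b r x y ^ k)
      \<partial>lborel_power b) \<in> borel_measurable (lborel_power a)"
proof -
  interpret B: sigma_finite_measure "lborel_power b"
    by (rule sigma_finite_lborel_power)
  show ?thesis by measurable
qed

lemma shifted_moment:
  assumes "0 \<le> c"
  shows "(\<integral>\<^sup>+x. \<integral>\<^sup>+y. indicator (steps a r) x * indicator (steps b r) y
       * ennreal ((area a b r x y + c) ^ k) \<partial>lborel_power b \<partial>lborel_power a)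
     = (\<Sum>i\<le>k. ennreal (real (k choose i) * c ^ (k - i)) * moment i a b r)" (is "?L = _")
proof -
  let ?f = "\<lambda>i x y. indicator (steps a r) x * indicator (steps b r) y * ennreal (area a b r x y ^ i)"
  have f [measurable]: "(\<lambda>(x, y). ?f i x y) \<in> borel_measurable (lborel_power a \<Otimes>\<^sub>M lborel_power b)" for i
    by measurable
  have fx: "?f i x \<in> borel_measurable (lborel_power b)"
    if "x \<in> space (lborel_power a)" for x i
    using measurable_compose[OF measurable_Pair1'[OF that] f[of i]] by simp
  have "indicator (steps a r) x * indicator (steps b r) y * ennreal ((area a b r x y + c) ^ k)
      = (\<Sum>i\<le>k. ennreal (real (k choose i) * c ^ (k - i)) * ?f i x y)" for x y
    using assms
    by (simp add: binomial_ring indicator_def area_nonneg ennreal_mult' sum_ennreal[symmetric] mult_ac)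
  then have "?L = (\<integral>\<^sup>+x. \<integral>\<^sup>+y. (\<Sum>i\<le>k. ennreal (real (k choose i) * c ^ (k - i)) * ?f i x y)
      \<partial>lborel_power b \<partial>lborel_power a)"
    by simp
  also have "\<dots> = (\<integral>\<^sup>+x. (\<Sum>i\<le>k. ennreal (real (k choose i) * c ^ (k - i))
      * (\<integral>\<^sup>+y. ?f i x y \<partial>lborel_power b)) \<partial>lborel_power a)"
  proof (rule nn_integral_cong)
    fix x assume x: "x \<in> space (lborel_power a)"
    show "(\<integral>\<^sup>+y. (\<Sum>i\<le>k. ennreal (real (k choose i) * c ^ (k - i)) * ?f i x y) \<partial>lborel_power b)
      = (\<Sum>i\<le>k. ennreal (real (k choose i) * c ^ (k - i)) * (\<integral>\<^sup>+y. ?f i x y \<partial>lborel_power b))"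
      by (subst nn_integral_sum, intro borel_measurable_times_ennreal borel_measurable_const fx[OF x])
         (intro sum.cong refl nn_integral_cmult fx[OF x])
  qed
  also have "\<dots> = (\<Sum>i\<le>k. ennreal (real (k choose i) * c ^ (k - i)) * moment i a b r)"
    unfolding moment_def
    by (subst nn_integral_sum, intro borel_measurable_times_ennreal borel_measurable_const
        borel_measurable_moment_integrand)
       (intro sum.cong refl nn_integral_cmult borel_measurable_moment_integrand)
  finally show ?thesis .
qed

lemma has_real_derivative_scaled_power:
  "((\<lambda>r::real. r ^ Suc p / fact (Suc p)) has_real_derivative r ^ p / fact p) (at r within S)"
  using DERIV_cdivide[OF DERIV_pow[of "Suc p" r S], of "fact (Suc p)"]
  by (simp del: power_Suc of_nat_Suc)

text \<open>
Euler's beta integral for natural exponents. Integration by parts trades a power of \<open>T - r\<close> for a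
power of \<open>r\<close>; the boundary terms vanish.
\<close>

lemma has_integral_power_product:
  assumes "0 \<le> (T :: real)"
  shows "((\<lambda>r. (T - r) ^ j / fact j * (r ^ p / fact p))
    has_integral T ^ (p + j + 1) / fact (p + j + 1)) {0..T}"
proof (induction j arbitrary: p)
  case 0
  have "((\<lambda>r. r ^ p / fact p) has_integral
      T ^ Suc p / fact (Suc p) - 0 ^ Suc p / fact (Suc p)) {0..T}"
    using assms has_real_derivative_scaled_power
    by (intro fundamental_theorem_of_calculus)
       (auto simp: has_real_derivative_iff_has_vector_derivative[symmetric] simp del: power_Suc fact_Suc)
  then show ?case by simp
next
  case (Suc j)
  let ?F = "\<lambda>r. (T - r) ^ Suc j / fact (Suc j) * (r ^ Suc p / fact (Suc p))"
  let ?G = "\<lambda>r. (T - r) ^ Suc j / fact (Suc j) * (r ^ p / fact p)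
      - (T - r) ^ j / fact j * (r ^ Suc p / fact (Suc p))"
  have left: "((\<lambda>r. (T - r) ^ Suc j / fact (Suc j)) has_real_derivative - ((T - r) ^ j / fact j))
      (at r within {0..T})" for r
    by (rule DERIV_chain2[OF has_real_derivative_scaled_power, THEN DERIV_cong])
       (auto intro!: derivative_eq_intros)
  have "(?F has_real_derivative ?G r) (at r within {0..T})" for r
    by (rule DERIV_mult[OF left has_real_derivative_scaled_power, THEN DERIV_cong]) (simp add: mult_ac)
  then have "(?G has_integral ?F T - ?F 0) {0..T}"
    using assms
    by (intro fundamental_theorem_of_calculus)
       (auto simp: has_real_derivative_iff_has_vector_derivative[symmetric] simp del: power_Suc fact_Suc)
  from has_integral_add[OF this Suc.IH[of "Suc p"]] show ?case by simp
qed

text \<open>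
Expanding the \<open>k\<close>-th power of the area plus \<open>\<bar>a + 1 - b\<bar> (T - r)\<close> binomially leaves one beta integral
for each \<open>i \<le> k\<close>. All of them are the same power of \<open>T\<close> divided by the same factorial, since the
factor \<open>(k - i)!\<close> is absorbed by the binomial coefficient.
\<close>

lemma dominated_moment_closed_form:
  assumes IH: "\<And>i r. 0 \<le> r \<Longrightarrow>
      moment i a b r = ennreal (path_weight i a b * (r ^ (a + b + i) / fact (a + b + i)))"
    and "0 \<le> T"
  shows "dominated_moment k (Suc a) b T = ennreal ((\<Sum>i\<le>k. fact k / fact i
      * \<bar>real (Suc a) - real b\<bar> ^ (k - i) * path_weight i a b)
      * (T ^ (Suc a + b + k) / fact (Suc a + b + k)))"
proof -
  define d where "d = \<bar>real (Suc a) - real b\<bar>"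
  define c where "c i = fact k / fact i * d ^ (k - i) * path_weight i a b" for i
  define h where "h i r = (T - r) ^ (k - i) / fact (k - i) * (r ^ (a + b + i) / fact (a + b + i))" for i r
  have d: "0 \<le> d" by (simp add: d_def)
  have c: "0 \<le> c i" for i
    using d by (simp add: c_def path_weight_nonneg)
  have h: "0 \<le> h i r" if "r \<in> {0..T}" for i r
    using that by (simp add: h_def)
  have h_meas [measurable]: "h i \<in> borel_measurable borel" for i
    unfolding h_def by measurable
  have h_int: "(\<integral>\<^sup>+r. ennreal (indicator {0..T} r * h i r) \<partial>lborel)
      = ennreal (T ^ (Suc a + b + k) / fact (Suc a + b + k))" if "i \<le> k" for i
  proof (rule nn_integral_has_integral_lebesgue)
    have "a + b + i + (k - i) + 1 = Suc a + b + k" using that by simp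
    with has_integral_power_product[OF \<open>0 \<le> T\<close>, of "k - i" "a + b + i"]
    show "(h i has_integral T ^ (Suc a + b + k) / fact (Suc a + b + k)) {0..T}"
      unfolding h_def by metis
  qed (rule h)
  have "dominated_moment k (Suc a) b T
      = (\<integral>\<^sup>+r. (\<Sum>i\<le>k. ennreal (c i) * ennreal (indicator {0..T} r * h i r)) \<partial>lborel)"
    unfolding dominated_moment_Suc d_def[symmetric]
  proof (rule nn_integral_cong)
    fix r :: real
    have "ennreal (real (k choose i) * (d * (T - r)) ^ (k - i)) * moment i a b r
        = ennreal (c i) * ennreal (h i r)" if "r \<in> {0..T}" "i \<le> k" for i
      using that d c[of i] h[of r i] IH[of r i]
      by (simp add: c_def h_def ennreal_mult'[symmetric] path_weight_nonneg
          binomial_fact power_mult_distrib mult_ac)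
    then show "indicator {0..T} r * (\<integral>\<^sup>+x. \<integral>\<^sup>+y. indicator (steps a r) x * indicator (steps b r) y
        * ennreal ((area a b r x y + d * (T - r)) ^ k) \<partial>lborel_power b \<partial>lborel_power a)
      = (\<Sum>i\<le>k. ennreal (c i) * ennreal (indicator {0..T} r * h i r))"
      using d by (cases "r \<in> {0..T}") (simp_all add: shifted_moment del: One_nat_def)
  qed
  also have "\<dots> = (\<Sum>i\<le>k. ennreal (c i) * (\<integral>\<^sup>+r. ennreal (indicator {0..T} r * h i r) \<partial>lborel))"
    by (simp add: nn_integral_sum nn_integral_cmult)
  also have "\<dots> = (\<Sum>i\<le>k. ennreal (c i * (T ^ (Suc a + b + k) / fact (Suc a + b + k))))"
    by (intro sum.cong refl) (subst h_int, simp_all only: atMost_iff ennreal_mult'[OF c])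
  also have "\<dots> = ennreal ((\<Sum>i\<le>k. c i) * (T ^ (Suc a + b + k) / fact (Suc a + b + k)))"
    unfolding sum_distrib_right using c \<open>0 \<le> T\<close> by (intro sum_ennreal) simp
  finally show ?thesis by (simp add: c_def d_def)
qed

lemma moment_origin:
  assumes "0 \<le> T" shows "moment k 0 0 T = of_bool (k = 0)"
  using assms
  by (simp add: moment_def PiM_empty nn_integral_count_space_finite steps_def area_def)

text \<open>
Induction on the number of points, by removing the largest one.
\<close>

lemma moment_closed_form:
  assumes "0 \<le> T"
  shows "moment k a b T = ennreal (path_weight k a b * (T ^ (a + b + k) / fact (a + b + k)))"
  using assms
proof (induction "a + b" arbitrary: a b k T rule: less_induct)
  case less
  \<comment> \<open>The part of the unrolled recursion that comes from \<open>(a-1,b)\<close>; the one from \<open>(a,b-1)\<close> is \<open>Q b a\<close>.\<close>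
  define Q where "Q a b = (\<Sum>i\<le>k. fact k / fact i * \<bar>real a - real b\<bar> ^ (k - i)
      * (if a = 0 then 0 else path_weight i (a - 1) b))" for a b
  have Q: "0 \<le> Q a b" for a b
    by (simp add: Q_def sum_nonneg path_weight_nonneg)
  have dom: "dominated_moment k a' b' T = ennreal (Q a' b' * (T ^ (a + b + k) / fact (a + b + k)))"
    if "a' + b' = a + b" "0 < a + b" for a' b'
  proof (cases a')
    case 0
    then show ?thesis using that by (simp add: Q_def dominated_moment_0)
  next
    case (Suc c)
    have "moment i c b' r = ennreal (path_weight i c b' * (r ^ (c + b' + i) / fact (c + b' + i)))"
      if "0 \<le> r" for i r
      using less.hyps[of c b' r i] that \<open>a' + b' = a + b\<close> Suc by simp
    note closed = dominated_moment_closed_form[OF this \<open>0 \<le> T\<close>, of k]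
    have total: "Suc c + b' + k = a + b + k" using that Suc by simp
    show ?thesis using closed unfolding total Q_def Suc by simp
  qed
  show ?case
  proof (cases "a + b = 0")
    case True
    then show ?thesis
      using less.prems by (simp add: moment_origin path_weight.simps)
  next
    case False
    then have pos: "a > 0 \<or> b > 0" "0 < a + b" by auto
    have "path_weight k a b = Q a b + Q b a"
      unfolding path_weight_unroll[OF pos(1)] Q_def
      by (simp add: sum.distrib[symmetric] distrib_left abs_minus_commute[of "real b"]
          path_weight_commute[of _ a] cong: if_cong)
    then show ?thesis
      using moment_split[OF pos(1), of k T] dom[of a b] dom[of b a] pos(2) Q less.prems
      by (simp add: ennreal_plus[symmetric] distrib_right add_divide_distrib add.commute[of b a] del: ennreal_plus)
  qed
qed

section \<open>The Wasserstein distance on a line\<close>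

definition mass_distance :: "nat \<Rightarrow> (nat \<Rightarrow> real) \<Rightarrow> (nat \<Rightarrow> real) \<Rightarrow> real" where
  "mass_distance n p q = (\<Sum>i\<in>{1..<n}. \<bar>sum p {1..i} - sum q {1..i}\<bar>)"

text \<open>
The distance of \<open>x\<close> and \<open>y\<close> is the number of cuts between \<open>i\<close> and \<open>i + 1\<close> that separate them. This
linearises the transport cost.
\<close>

lemma abs_diff_eq_sum_crossings:
  assumes "x \<in> {1..n}" "y \<in> {1..n}"
  shows "\<bar>real x - real y\<bar> = (\<Sum>i\<in>{1..<n}. \<bar>of_bool (x \<le> i) - of_bool (y \<le> i)\<bar>)"
  using assms
proof (induction x y rule: linorder_wlog)
  case (le x y)
  have "(\<Sum>i\<in>{1..<n}. \<bar>of_bool (x \<le> i) - of_bool (y \<le> i)\<bar> :: real)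
      = (\<Sum>i\<in>{1..<n}. if i \<in> {x..<y} then 1 else 0)"
    using le by (intro sum.cong) auto
  also have "\<dots> = (\<Sum>i\<in>{1..<n} \<inter> {x..<y}. 1)"
    by (rule sum.inter_restrict[symmetric]) simp
  also have "{1..<n} \<inter> {x..<y} = {x..<y}" using le by auto
  finally show ?case using le by simp
next
  case (sym x y)
  then show ?case by (simp add: abs_minus_commute)
qed

lemma prob_atMost_pmf_of_vec:
  assumes "p \<in> prob_simplex n" "i \<le> n"
  shows "measure_pmf.prob (pmf_of_vec n p) {..i} = sum p {1..i}"
proof -
  have "measure_pmf.prob (pmf_of_vec n p) {..i} = (\<Sum>j\<in>{..i}. if j \<in> {1..n} then p j else 0)"
    by (simp add: measure_measure_pmf_finite pmf_pmf_of_vec[OF assms(1)])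
  also have "\<dots> = (\<Sum>j\<in>{..i} \<inter> {1..n}. p j)"
    by (rule sum.inter_restrict[symmetric]) simp
  also have "{..i} \<inter> {1..n} = {1..i}" using assms(2) by auto
  finally show ?thesis .
qed

lemma set_pmf_of_vec: "p \<in> prob_simplex n \<Longrightarrow> set_pmf (pmf_of_vec n p) \<subseteq> {1..n}"
  by (auto simp: set_pmf_eq pmf_pmf_of_vec split: if_splits)

text \<open>
The mass that a coupling moves across a cut is at least the absolute value of the net flow, which
is fixed by the marginals.
\<close>

lemma mass_distance_le_coupling:
  assumes p: "p \<in> prob_simplex n" and q: "q \<in> prob_simplex n"
    and \<pi>: "\<pi> \<in> couplings (pmf_of_vec n p) (pmf_of_vec n q)"
  shows "mass_distance n p q \<le> measure_pmf.expectation \<pi> (\<lambda>(x, y). \<bar>real x - real y\<bar>)"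
proof -
  have marginals: "map_pmf fst \<pi> = pmf_of_vec n p" "map_pmf snd \<pi> = pmf_of_vec n q"
    using \<pi> by (auto simp: couplings_def)
  have "fst ` set_pmf \<pi> \<subseteq> {1..n}" "snd ` set_pmf \<pi> \<subseteq> {1..n}"
    using set_pmf_of_vec[OF p] set_pmf_of_vec[OF q] unfolding marginals[symmetric] by simp_all
  then have supp: "fst z \<in> {1..n}" "snd z \<in> {1..n}" if "z \<in> set_pmf \<pi>" for z
    using that by auto
  then have "set_pmf \<pi> \<subseteq> {1..n} \<times> {1..n}" by force
  then have "finite (set_pmf \<pi>)" by (rule finite_subset) simp
  then have int: "integrable \<pi> f" for f :: "nat \<times> nat \<Rightarrow> real"
    by (rule integrable_measure_pmf_finite)
  have cdf: "sum p {1..i} = measure_pmf.expectation \<pi> (\<lambda>z. of_bool (fst z \<le> i))"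
    "sum q {1..i} = measure_pmf.expectation \<pi> (\<lambda>z. of_bool (snd z \<le> i))" if "i < n" for i
  proof -
    have ind: "of_bool (f z \<le> i) = indicat_real (f -` {..i}) z" for f :: "nat \<times> nat \<Rightarrow> nat" and z
      by (simp add: indicator_def)
    show "sum p {1..i} = measure_pmf.expectation \<pi> (\<lambda>z. of_bool (fst z \<le> i))"
      using prob_atMost_pmf_of_vec[OF p, of i] that unfolding marginals[symmetric] ind by simp
    show "sum q {1..i} = measure_pmf.expectation \<pi> (\<lambda>z. of_bool (snd z \<le> i))"
      using prob_atMost_pmf_of_vec[OF q, of i] that unfolding marginals[symmetric] ind by simp
  qed
  have "mass_distance n p q = (\<Sum>i\<in>{1..<n}. \<bar>measure_pmf.expectation \<pi>
      (\<lambda>z. of_bool (fst z \<le> i) - of_bool (snd z \<le> i))\<bar>)"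
    unfolding mass_distance_def by (intro sum.cong refl) (simp add: cdf int del: One_nat_def)
  also have "\<dots> \<le> (\<Sum>i\<in>{1..<n}. measure_pmf.expectation \<pi>
      (\<lambda>z. \<bar>of_bool (fst z \<le> i) - of_bool (snd z \<le> i)\<bar>))"
    by (intro sum_mono integral_abs_bound)
  also have "\<dots> = measure_pmf.expectation \<pi>
      (\<lambda>z. \<Sum>i\<in>{1..<n}. \<bar>of_bool (fst z \<le> i) - of_bool (snd z \<le> i)\<bar>)"
    by (simp add: int)
  also have "\<dots> = measure_pmf.expectation \<pi> (\<lambda>(x, y). \<bar>real x - real y\<bar>)"
    using supp abs_diff_eq_sum_crossings[of "fst z" n "snd z" for z]
    by (intro integral_cong_AE) (auto simp: AE_measure_pmf_iff split_beta')
  finally show ?thesis .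
qed

text \<open>
The generalised inverse of the distribution function, written as a count so that measurability and
the comparison of two quantiles reduce to single cuts. The cut at \<open>n\<close> is left out, hence the values
lie in \<open>{1..n}\<close> for every real \<open>u\<close>, provided \<open>n \<ge> 1\<close>.
\<close>

definition quantile :: "nat \<Rightarrow> (nat \<Rightarrow> real) \<Rightarrow> real \<Rightarrow> nat" where
  "quantile n p u = Suc (card {i \<in> {1..<n}. sum p {1..i} < u})"

lemma quantile_eq_iff:
  assumes p: "p \<in> prob_simplex n" and "n \<ge> 1" and u: "0 < u" "u \<le> 1"
  shows "quantile n p u = i \<longleftrightarrow> i \<in> {1..n} \<and> sum p {1..i - 1} < u \<and> u \<le> sum p {1..i}"
proof
  let ?A = "{i \<in> {1..<n}. sum p {1..i} < u}"
  have mono: "sum p {1..i} \<le> sum p {1..j}" if "i \<le> j" "j \<le> n" for i j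
    using p that by (intro sum_mono2) (auto simp: prob_simplex_def)
  have total: "sum p {1..n} = 1" using p by (simp add: prob_simplex_def)
  {
    assume i: "quantile n p u = i"
    then have card: "i = Suc (card ?A)" by (simp add: quantile_def)
    have "card ?A \<le> card {1..<n}" by (intro card_mono) auto
    then have "i \<in> {1..n}" using card \<open>n \<ge> 1\<close> by auto
    moreover have "sum p {1..i - 1} < u"
    proof (rule ccontr)
      assume *: "\<not> sum p {1..i - 1} < u"
      have "?A \<subseteq> {1..<i - 1}"
      proof
        fix j assume j: "j \<in> ?A"
        then have "\<not> i - 1 \<le> j" using mono[of "i - 1" j] * by auto
        then show "j \<in> {1..<i - 1}" using j by auto
      qed
      then have "card ?A \<le> card {1..<i - 1}" by (intro card_mono) auto
      moreover have "i > 1" using * u \<open>i \<in> {1..n}\<close> by (cases "i = 1") auto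
      ultimately show False using card by simp
    qed
    moreover have "u \<le> sum p {1..i}"
    proof (rule ccontr)
      assume *: "\<not> u \<le> sum p {1..i}"
      with total u have "i \<noteq> n" by auto
      with \<open>i \<in> {1..n}\<close> have "i < n" by auto
      have "{1..i} \<subseteq> ?A"
      proof
        fix j assume "j \<in> {1..i}"
        then show "j \<in> ?A" using mono[of j i] * \<open>i < n\<close> by auto
      qed
      then have "card {1..i} \<le> card ?A" by (intro card_mono) auto
      then show False using card by simp
    qed
    ultimately show "i \<in> {1..n} \<and> sum p {1..i - 1} < u \<and> u \<le> sum p {1..i}" by simp
  next
    assume i: "i \<in> {1..n} \<and> sum p {1..i - 1} < u \<and> u \<le> sum p {1..i}"
    have "?A = {1..<i}"
    proof (intro equalityI subsetI)
      fix j assume j: "j \<in> ?A"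
      then have "\<not> i \<le> j" using mono[of i j] i by auto
      then show "j \<in> {1..<i}" using j by auto
    next
      fix j assume j: "j \<in> {1..<i}"
      then have "j \<le> i - 1" "i - 1 \<le> n" using i by auto
      with mono[of j "i - 1"] have "sum p {1..j} < u" using i by linarith
      then show "j \<in> ?A" using i j by auto
    qed
    then show "quantile n p u = i" using i by (simp add: quantile_def)
  }
qed

definition uniform_unit :: "real measure" where
  "uniform_unit = uniform_measure lborel {0<..1}"

lemma prob_space_uniform_unit: "prob_space uniform_unit"
  unfolding uniform_unit_def by (rule prob_space_uniform_measure) simp_all

lemma sets_uniform_unit [simp, measurable_cong]: "sets uniform_unit = sets borel"
  by (simp add: uniform_unit_def)

lemma space_uniform_unit [simp]: "space uniform_unit = UNIV"
  by (simp add: uniform_unit_def)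

lemma AE_uniform_unit: "AE u in uniform_unit. 0 < u \<and> u \<le> 1"
  unfolding uniform_unit_def by (rule AE_uniform_measureI) auto

lemma measure_uniform_unit_Ioc:
  assumes "0 \<le> s" "s \<le> t" "t \<le> 1" shows "measure uniform_unit {s<..t} = t - s"
proof -
  have "{0<..1} \<inter> {s<..t} = {s<..t}" using assms by auto
  then show ?thesis
    unfolding uniform_unit_def using assms by (subst measure_uniform_measure) simp_all
qed

lemma measurable_quantile [measurable]:
  "quantile n p \<in> uniform_unit \<rightarrow>\<^sub>M count_space UNIV"
proof -
  have "quantile n p = (\<lambda>u. Suc (\<Sum>i\<in>{1..<n}. if sum p {1..i} < u then 1 else 0))"
    unfolding quantile_def card_eq_sum by (subst sum.inter_filter) auto
  then show ?thesis by simp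
qed

lemma measurable_quantile_pair [measurable]:
  "(\<lambda>u. (quantile n p u, quantile n q u)) \<in> uniform_unit \<rightarrow>\<^sub>M count_space UNIV" (is "?Q \<in> _")
proof (subst measurable_count_space_eq2_countable, safe)
  fix i j
  have "?Q -` {(i, j)} = quantile n p -` {i} \<inter> quantile n q -` {j}" by auto
  then show "?Q -` {(i, j)} \<inter> space uniform_unit \<in> sets uniform_unit"
    using measurable_sets[OF measurable_quantile[of n p], of "{i}"]
      measurable_sets[OF measurable_quantile[of n q], of "{j}"] by auto
qed auto

text \<open>
Feeding one and the same uniform variable into both quantile functions couples the two measures,
because the level sets of a quantile function are intervals whose lengths are the point masses.
\<close>

lemma exists_quantile_coupling:
  assumes p: "p \<in> prob_simplex n" and q: "q \<in> prob_simplex n" and n: "n \<ge> 1"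
  shows "\<exists>\<pi>\<in>couplings (pmf_of_vec n p) (pmf_of_vec n q).
    measure_pmf \<pi> = distr uniform_unit (count_space UNIV) (\<lambda>u. (quantile n p u, quantile n q u))"
proof -
  interpret U: prob_space uniform_unit by (rule prob_space_uniform_unit)
  let ?Q = "\<lambda>u. (quantile n p u, quantile n q u)"
  let ?J = "distr uniform_unit (count_space UNIV) ?Q"
  interpret J: prob_space ?J by (rule U.prob_space_distr) simp
  have "AE z in ?J. measure ?J {z} \<noteq> 0"
    by (subst J.AE_support_countable) (auto intro!: exI[of _ UNIV])
  then have J: "measure_pmf (Abs_pmf ?J) = ?J"
    by (intro Abs_pmf_inverse) (auto intro: J.prob_space_axioms)
  have marginal: "measure uniform_unit (quantile n r -` {i}) = pmf (pmf_of_vec n r) i"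
    if r: "r \<in> prob_simplex n" for r i
  proof (cases "i \<in> {1..n}")
    case True
    have "measure uniform_unit (quantile n r -` {i})
        = measure uniform_unit {sum r {1..i - 1}<..sum r {1..i}}"
    proof (rule U.finite_measure_eq_AE)
      show "AE u in uniform_unit. u \<in> quantile n r -` {i} \<longleftrightarrow> u \<in> {sum r {1..i - 1}<..sum r {1..i}}"
        using AE_uniform_unit by eventually_elim (use quantile_eq_iff[OF r n] True in auto)
    qed (use measurable_sets[OF measurable_quantile[of n r], of "{i}"] in auto)
    also have "\<dots> = sum r {1..i} - sum r {1..i - 1}"
    proof (rule measure_uniform_unit_Ioc)
      have nonneg: "0 \<le> r j" if "j \<in> {1..n}" for j using r that by (simp add: prob_simplex_def)
      show "0 \<le> sum r {1..i - 1}" using True by (intro sum_nonneg nonneg) auto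
      show "sum r {1..i - 1} \<le> sum r {1..i}" using True by (intro sum_mono2 nonneg) auto
      have "sum r {1..i} \<le> sum r {1..n}" using True by (intro sum_mono2 nonneg) auto
      then show "sum r {1..i} \<le> 1" using r by (simp add: prob_simplex_def)
    qed
    also have "\<dots> = r i" using True by (cases i) auto
    finally show ?thesis using True by (simp add: pmf_pmf_of_vec[OF r])
  next
    case False
    have "measure uniform_unit (quantile n r -` {i}) = measure uniform_unit {}"
    proof (rule U.finite_measure_eq_AE)
      show "AE u in uniform_unit. u \<in> quantile n r -` {i} \<longleftrightarrow> u \<in> {}"
        using AE_uniform_unit by eventually_elim (use quantile_eq_iff[OF r n] False in auto)
    qed (use measurable_sets[OF measurable_quantile[of n r], of "{i}"] in auto)
    then show ?thesis using False by (auto simp: pmf_pmf_of_vec[OF r])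
  qed
  have "map_pmf fst (Abs_pmf ?J) = pmf_of_vec n p"
  proof (rule pmf_eqI)
    fix i
    have "pmf (map_pmf fst (Abs_pmf ?J)) i = measure ?J (fst -` {i})"
      by (simp add: pmf_map J)
    also have "\<dots> = measure uniform_unit (quantile n p -` {i})"
      by (subst measure_distr) (auto intro!: arg_cong[where f = "measure uniform_unit"])
    finally show "pmf (map_pmf fst (Abs_pmf ?J)) i = pmf (pmf_of_vec n p) i"
      by (simp add: marginal[OF p])
  qed
  moreover have "map_pmf snd (Abs_pmf ?J) = pmf_of_vec n q"
  proof (rule pmf_eqI)
    fix i
    have "pmf (map_pmf snd (Abs_pmf ?J)) i = measure ?J (snd -` {i})"
      by (simp add: pmf_map J)
    also have "\<dots> = measure uniform_unit (quantile n q -` {i})"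
      by (subst measure_distr) (auto intro!: arg_cong[where f = "measure uniform_unit"])
    finally show "pmf (map_pmf snd (Abs_pmf ?J)) i = pmf (pmf_of_vec n q) i"
      by (simp add: marginal[OF q])
  qed
  ultimately show ?thesis using J by (intro bexI[of _ "Abs_pmf ?J"]) (auto simp: couplings_def)
qed

text \<open>
The quantile coupling attains the lower bound: for fixed \<open>u\<close>, a cut \<open>i\<close> separates the two quantiles
only if \<open>u\<close> lies between the two cumulative masses at \<open>i\<close>, which has probability equal to their
distance.
\<close>

lemma W1_eq_mass_distance:
  assumes p: "p \<in> prob_simplex n" and q: "q \<in> prob_simplex n" and n: "n \<ge> 1"
  shows "W1 (pmf_of_vec n p) (pmf_of_vec n q) = mass_distance n p q"
proof -
  interpret U: prob_space uniform_unit by (rule prob_space_uniform_unit)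
  obtain \<pi> where \<pi>: "\<pi> \<in> couplings (pmf_of_vec n p) (pmf_of_vec n q)"
    and \<pi>_eq: "measure_pmf \<pi> = distr uniform_unit (count_space UNIV) (\<lambda>u. (quantile n p u, quantile n q u))"
    using exists_quantile_coupling[OF p q n] by blast
  have Q: "(\<lambda>u. (quantile n p u, quantile n q u)) \<in> uniform_unit \<rightarrow>\<^sub>M count_space UNIV"
    by (rule measurable_quantile_pair)
  have int: "integrable uniform_unit (indicat_real {s<..t})" for s t
    by (rule U.integrable_const_bound[where B = 1]) (auto simp: indicator_def)
  let ?lo = "\<lambda>i. min (sum p {1..i}) (sum q {1..i})" and ?hi = "\<lambda>i. max (sum p {1..i}) (sum q {1..i})"
  have bounds: "0 \<le> sum r {1..i}" "sum r {1..i} \<le> 1" if "r \<in> prob_simplex n" "i < n" for r i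
  proof -
    have "sum r {1..i} \<le> sum r {1..n}" using that by (intro sum_mono2) (auto simp: prob_simplex_def)
    then show "0 \<le> sum r {1..i}" "sum r {1..i} \<le> 1"
      using that by (auto simp: prob_simplex_def intro: sum_nonneg)
  qed
  have pointwise: "\<bar>real (quantile n p u) - real (quantile n q u)\<bar>
      \<le> (\<Sum>i\<in>{1..<n}. indicat_real {?lo i<..?hi i} u)" for u
  proof -
    have quant: "real (quantile n r u) = 1 + (\<Sum>i\<in>{1..<n}. of_bool (sum r {1..i} < u))" for r
      unfolding quantile_def of_nat_Suc card_eq_sum
      by (subst sum.inter_filter) (auto simp: of_bool_def intro!: sum.cong)
    have "real (quantile n p u) - real (quantile n q u)
        = (\<Sum>i\<in>{1..<n}. of_bool (sum p {1..i} < u) - of_bool (sum q {1..i} < u))"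
      by (simp add: quant sum_subtractf)
    also have "\<bar>\<dots>\<bar> \<le> (\<Sum>i\<in>{1..<n}. \<bar>of_bool (sum p {1..i} < u) - of_bool (sum q {1..i} < u)\<bar>)"
      by (rule sum_abs)
    also have "\<dots> \<le> (\<Sum>i\<in>{1..<n}. indicat_real {?lo i<..?hi i} u)"
      by (intro sum_mono) (auto simp: indicator_def)
    finally show ?thesis .
  qed
  have "measure_pmf.expectation \<pi> (\<lambda>(x, y). \<bar>real x - real y\<bar>)
      = (\<integral>u. \<bar>real (quantile n p u) - real (quantile n q u)\<bar> \<partial>uniform_unit)"
    unfolding \<pi>_eq by (subst integral_distr[OF Q]) simp_all
  also have "\<dots> \<le> (\<integral>u. (\<Sum>i\<in>{1..<n}. indicat_real {?lo i<..?hi i} u) \<partial>uniform_unit)"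
    by (intro integral_mono' pointwise Bochner_Integration.integrable_sum int sum_nonneg) simp
  also have "\<dots> = (\<Sum>i\<in>{1..<n}. measure uniform_unit {?lo i<..?hi i})"
    by (subst Bochner_Integration.integral_sum) (simp_all add: int)
  also have "\<dots> = (\<Sum>i\<in>{1..<n}. ?hi i - ?lo i)"
    using bounds[OF p] bounds[OF q] by (intro sum.cong refl measure_uniform_unit_Ioc) (auto simp: min_def max_def)
  also have "\<dots> = mass_distance n p q"
    unfolding mass_distance_def by (intro sum.cong) (auto simp: min_def max_def)
  finally have "measure_pmf.expectation \<pi> (\<lambda>(x, y). \<bar>real x - real y\<bar>) = mass_distance n p q"
    using mass_distance_le_coupling[OF p q \<pi>] by linarith
  then show ?thesis
    unfolding W1_def using \<pi> mass_distance_le_coupling[OF p q]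
    by (intro cInf_eq_minimum) (auto intro!: image_eqI[of _ _ \<pi>])
qed

section \<open>The second moment over pairs of uniform measures\<close>

lemma nn_integral_uniform_simplex:
  assumes n: "n \<ge> 1" and f [measurable]: "f \<in> borel_measurable (uniform_simplex n)"
  shows "(\<integral>\<^sup>+p. f p \<partial>uniform_simplex n)
    = fact (n - 1) * (\<integral>\<^sup>+x. indicator (steps (n - 1) 1) x * f (simplex_chart n x) \<partial>lborel_power (n - 1))"
proof -
  have I: "{1..<n} = {1..n - 1}" using n by auto
  let ?P = "Pi\<^sub>M {1..<n} (\<lambda>_. lborel :: real measure)"
  have fv [measurable]: "f \<in> borel_measurable (simplex_volume n)"
    using f by (simp add: uniform_simplex_def)
  have S: "prob_simplex n \<in> sets (simplex_volume n)"
    using sets.top[of "simplex_volume n"] by (simp add: space_simplex_volume)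
  have "(\<integral>\<^sup>+p. f p \<partial>uniform_simplex n)
      = (\<integral>\<^sup>+p. f p * indicator (prob_simplex n) p \<partial>simplex_volume n) / (1 / fact (n - 1))"
    unfolding uniform_simplex_def
    by (simp only: nn_integral_uniform_measure[OF fv S] emeasure_simplex_volume[OF n])
  also have "\<dots> = fact (n - 1) * (\<integral>\<^sup>+p. f p * indicator (prob_simplex n) p \<partial>simplex_volume n)"
  proof -
    have "inverse (1 / fact (n - 1) :: ennreal) = inverse (inverse (ennreal (fact (n - 1))))"
      by (simp only: divide_ennreal_def mult_1_left ennreal_fact)
    also have "\<dots> = fact (n - 1)"
      by (subst inverse_ennreal, simp, subst inverse_ennreal) (simp_all only: inverse_inverse_eq
          inverse_positive_iff_positive fact_gt_zero ennreal_fact)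
    finally show ?thesis
      by (simp only: divide_ennreal_def[of _ "1 / fact (n - 1)"] mult.commute)
  qed
  also have "(\<integral>\<^sup>+p. f p * indicator (prob_simplex n) p \<partial>simplex_volume n) = (\<integral>\<^sup>+p. f p \<partial>simplex_volume n)"
    by (intro nn_integral_cong) (simp add: space_simplex_volume)
  also have "\<dots> = (\<integral>\<^sup>+x. f (simplex_chart n x) \<partial>restrict_space ?P (corner_simplex n))"
    using fv unfolding simplex_volume_def
    by (intro nn_integral_distr measurable_simplex_chart[OF n]) (simp add: simplex_volume_def)
  also have "\<dots> = (\<integral>\<^sup>+x. f (simplex_chart n x) * indicator (corner_simplex n) x \<partial>?P)"
    by (intro nn_integral_restrict_space sets.Int sets_corner_simplex sets.top)
  also have "\<dots> = (\<integral>\<^sup>+x. indicator (steps (n - 1) 1) x * f (simplex_chart n x) \<partial>?P)"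
    by (intro nn_integral_cong)
       (auto simp: indicator_def corner_simplex_def steps_def space_PiM PiE_def I[symmetric] simp del: One_nat_def)
  finally show ?thesis unfolding I .
qed

text \<open>
The increments of the chart are the first \<open>n - 1\<close> masses, so their partial sums are the cumulative masses.
\<close>

lemma mass_distance_chart:
  assumes n: "n \<ge> 1"
  shows "mass_distance n (simplex_chart n x) (simplex_chart n y) = area (n - 1) (n - 1) 1 x y"
proof -
  have "sum (simplex_chart n z) {1..i} = sum z {1..i}" if "i < n" for i z
    using that by (intro sum.cong) (auto simp: simplex_chart_def)
  moreover have "{1..<n} = {1..n - 1}" using n by auto
  ultimately show ?thesis
    using n unfolding mass_distance_def area_def by (intro sum.cong) (auto simp: level_def)
qed

lemma measurable_mass_distance:
  "(\<lambda>(p, q). mass_distance n p q) \<in> borel_measurable (Omega n)"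
proof -
  have "borel_measurable (uniform_simplex n)
      = (borel_measurable (restrict_space (Pi\<^sub>M {1..n} (\<lambda>_. borel)) (prob_simplex n))
         :: ((nat \<Rightarrow> real) \<Rightarrow> real) set)"
    by (rule measurable_cong_sets) (simp_all add: uniform_simplex_def simplex_volume_def)
  moreover have "(\<lambda>p. p i) \<in> borel_measurable
      (restrict_space (Pi\<^sub>M {1..n} (\<lambda>_. borel :: real measure)) (prob_simplex n))" if "i \<in> {1..n}" for i
    by (rule measurable_restrict_space1, rule measurable_component_singleton, rule that)
  ultimately have "(\<lambda>p. p i) \<in> borel_measurable (uniform_simplex n)" if "i \<in> {1..n}" for i
    using that by simp
  then have cdf: "(\<lambda>p. sum p {1..i}) \<in> borel_measurable (uniform_simplex n)" if "i \<in> {1..<n}" for i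
    using that by (intro borel_measurable_sum) auto
  show ?thesis
    unfolding mass_distance_def Omega_def split_beta'
    by (rule borel_measurable_sum, rule borel_measurable_abs, rule borel_measurable_diff)
       (rule measurable_compose[OF measurable_fst cdf] measurable_compose[OF measurable_snd cdf], assumption)+
qed

theorem theorem2:
  fixes n :: nat
  assumes "n \<ge> 1"
  shows "prob_space.expectation (Omega n) (\<lambda>\<omega>. (X n \<omega>)\<^sup>2)
           = (real n - 1) * (7 * real n - 4) / (30 * real n)"
proof -
  define m where "m = n - 1"
  have n: "n = Suc m" using assms by (simp add: m_def)
  interpret S: prob_space "uniform_simplex n" by (rule prob_space_uniform_simplex[OF assms])
  let ?d = "\<lambda>p q. ennreal ((mass_distance n p q)\<^sup>2)"
  have meas: "(\<lambda>(p, q). ?d p q) \<in> borel_measurable (uniform_simplex n \<Otimes>\<^sub>M uniform_simplex n)"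
    using measurable_mass_distance[of n] unfolding Omega_def split_beta' by measurable
  have meas_q: "?d p \<in> borel_measurable (uniform_simplex n)" if "p \<in> space (uniform_simplex n)" for p
    using measurable_compose[OF measurable_Pair1'[OF that] meas] by simp
  have "prob_space.expectation (Omega n) (\<lambda>\<omega>. (X n \<omega>)\<^sup>2)
      = prob_space.expectation (Omega n) (\<lambda>(p, q). (mass_distance n p q)\<^sup>2)"
    by (intro Bochner_Integration.integral_cong refl)
       (auto simp: Omega_def X_def space_pair_measure space_uniform_simplex W1_eq_mass_distance[OF _ _ assms])
  also have "\<dots> = enn2real (\<integral>\<^sup>+(p, q). ?d p q \<partial>Omega n)"
    using measurable_mass_distance[of n]
    by (subst integral_eq_nn_integral) (auto simp: split_beta')
  also have "(\<integral>\<^sup>+(p, q). ?d p q \<partial>Omega n) = (\<integral>\<^sup>+p. \<integral>\<^sup>+q. ?d p q \<partial>uniform_simplex n \<partial>uniform_simplex n)"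
    unfolding Omega_def using S.nn_integral_fst[OF meas] by simp
  also have "\<dots> = fact m * (\<integral>\<^sup>+x. indicator (steps m 1) x *
      (\<integral>\<^sup>+q. ?d (simplex_chart n x) q \<partial>uniform_simplex n) \<partial>lborel_power m)"
    unfolding m_def by (intro nn_integral_uniform_simplex assms S.borel_measurable_nn_integral meas)
  also have "(\<integral>\<^sup>+x. indicator (steps m 1) x *
      (\<integral>\<^sup>+q. ?d (simplex_chart n x) q \<partial>uniform_simplex n) \<partial>lborel_power m)
    = (\<integral>\<^sup>+x. fact m * (\<integral>\<^sup>+y. indicator (steps m 1) x * indicator (steps m 1) y
        * ennreal (area m m 1 x y ^ 2) \<partial>lborel_power m) \<partial>lborel_power m)"
  proof (rule nn_integral_cong)
    fix x assume x: "x \<in> space (lborel_power m)"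
    show "indicator (steps m 1) x * (\<integral>\<^sup>+q. ?d (simplex_chart n x) q \<partial>uniform_simplex n)
      = fact m * (\<integral>\<^sup>+y. indicator (steps m 1) x * indicator (steps m 1) y
        * ennreal (area m m 1 x y ^ 2) \<partial>lborel_power m)"
    proof (cases "x \<in> steps m 1")
      case True
      with x have "x \<in> corner_simplex n"
        by (auto simp: n corner_simplex_def steps_def space_PiM PiE_def atLeastLessThanSuc_atLeastAtMost)
      then have "simplex_chart n x \<in> space (uniform_simplex n)"
        using bij_betw_simplex_chart[OF assms] by (auto simp: bij_betw_def space_uniform_simplex)
      from nn_integral_uniform_simplex[OF assms meas_q[OF this]] show ?thesis
        using True unfolding mass_distance_chart[OF assms] m_def[symmetric] by simp
    qed simp
  qed
  also have "\<dots> = fact m * moment 2 m m 1"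
    unfolding moment_def by (rule nn_integral_cmult) measurable
  also have "moment 2 m m 1 = ennreal (path_weight 2 m m / fact (m + m + 2))"
    by (simp add: moment_closed_form)
  also have "enn2real (fact m * (fact m * ennreal (path_weight 2 m m / fact (m + m + 2))))
      = fact m * (fact m * (path_weight 2 m m / fact (m + m + 2)))"
    by (simp add: ennreal_fact[symmetric] enn2real_mult path_weight_nonneg)
  also have "\<dots> = real m * (7 * m + 3) / (30 * (m + 1))"
    by (rule path_weight_2_normalized)
  also have "\<dots> = (real n - 1) * (7 * real n - 4) / (30 * real n)"
    by (simp add: n)
  finally show ?thesis .
qed

end
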